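(* Let $P$ be an ad allocation linear program with disjoint groups $G$ and with $ctr_i=1$ for all $i\in[n]$, and let $v_{max}=\max_{i\in[n]} v_i$. Let $x\in[0,1]^n$ be a fractional solution satisfying the constraints of $P$ and the condition $$\forall g\in G,\ \forall i,i'\in g\ \text{ with } x_i,x_{i'}\in(0,1):\qquad v_i>v_{i'}\implies cpc_i>cpc_{i'}.$$ For every $g\in G$, let $S_g=\{i\in[n] : g_i=1,\ x_i\in(0,1)\}$. Let $y\in\{0,1\}^n$ be the output of applying the deterministic rounding procedure to every set $S_g$, $g\in G$ (with $y_i=x_i$ for all $i$ with $x_i\in\{0,1\}$). Then $$\sum_{i\in[n]} y_i\, cpc_i\ \le\ \sum_{i\in[n]} x_i\, cpc_i\ \le\ B,$$ $$\sum_{i\in[n]} y_i g_i+1\ \ge\ \mu_g\sum_{i\in[n]} y_i\qquad\text{for all } g\in G,$$ $$\sum_{i\in[n]} y_i v_i\ \ge\ \sum_{i\in[n]} x_i\, ctr_i\, v_i-|G|\,v_{max}.$$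
   Context: An ad allocation linear program is given by the following data: queries (individuals) $[n]=\{1,\dots,n\}$; for each $i$ a click-through rate $ctr_i\in[0,1]$, a cost-per-click $cpc_i\ge 0$ and a value $v_i\ge 0$; a budget $B\ge 0$; a finite family $G$ of groups $g\subseteq[n]$; and for each $g\in G$ a target fraction $\mu_g\in[0,1]$. Write $g_i:=\mathbf{1}[i\in g]$. The relaxed program is $$\text{maximize } \sum_i x_i\, ctr_i\, v_i\quad\text{subject to}\quad \sum_i x_i\, ctr_i\, cpc_i\le B,\qquad \sum_i x_i\, ctr_i(\mu_g-g_i)\le 0\ \ \forall g\in G,\qquad 0\le x_i\le 1\ \ \forall i.$$ "Disjoint groups" means that each individual $i\in[n]$ satisfies $g_i=1$ for exactly one $g\in G$ (some groups may have no constraint, i.e. $\mu_g=0$). Deterministic rounding procedure for a single set $S=\{i_1,\dots,i_t\}$: the elements are ordered so that $v_{i_1}\le v_{i_2}\le\cdots\le v_{i_t}$, with ties in $v$ ordered by $cpc$ (nondecreasing). For $j=t,t-1,\dots,1$ in this order, set $$y_{i_j}=1\ \text{ if }\ x_{i_j}+\sum_{l>j}(x_{i_l}-y_{i_l})\ge 1,\qquad y_{i_j}=0\ \text{ otherwise.}$$ *)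

theory Defs
  imports Complex_Main
begin

record ad_program =
  num    :: nat
  ctr    :: "nat \<Rightarrow> real"
  cpc    :: "nat \<Rightarrow> real"
  val    :: "nat \<Rightarrow> real"
  budget :: real
  groups :: "nat set set"
  target :: "nat set \<Rightarrow> real"

abbreviation queries :: "ad_program \<Rightarrow> nat set" where
  "queries P \<equiv> {1..num P}"

definition ad_allocation_lp :: "ad_program \<Rightarrow> bool" where
  "ad_allocation_lp P \<longleftrightarrow>
     (\<forall>i\<in>queries P. 0 \<le> ctr P i \<and> ctr P i \<le> 1 \<and> 0 \<le> cpc P i \<and> 0 \<le> val P i) \<and>
     0 \<le> budget P \<and>
     finite (groups P) \<and>
     (\<forall>g\<in>groups P. g \<subseteq> queries P \<and> 0 \<le> target P g \<and> target P g \<le> 1)"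

definition objective :: "ad_program \<Rightarrow> (nat \<Rightarrow> real) \<Rightarrow> real" where
  "objective P x = (\<Sum>i\<in>queries P. x i * ctr P i * val P i)"

definition feasible :: "ad_program \<Rightarrow> (nat \<Rightarrow> real) \<Rightarrow> bool" where
  "feasible P x \<longleftrightarrow>
     (\<Sum>i\<in>queries P. x i * ctr P i * cpc P i) \<le> budget P \<and>
     (\<forall>g\<in>groups P. (\<Sum>i\<in>queries P. x i * ctr P i * (target P g - of_bool (i \<in> g))) \<le> 0) \<and>
     (\<forall>i\<in>queries P. 0 \<le> x i \<and> x i \<le> 1)"

definition disjoint_groups :: "ad_program \<Rightarrow> bool" where
  "disjoint_groups P \<longleftrightarrow> (\<forall>i\<in>queries P. \<exists>!g. g \<in> groups P \<and> i \<in> g)"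

definition fractional_part_of_group :: "ad_program \<Rightarrow> (nat \<Rightarrow> real) \<Rightarrow> nat set \<Rightarrow> nat set" where
  "fractional_part_of_group P x g = {i \<in> queries P. i \<in> g \<and> 0 < x i \<and> x i < 1}"

definition rounding_order :: "ad_program \<Rightarrow> nat set \<Rightarrow> nat list \<Rightarrow> bool" where
  "rounding_order P S ks \<longleftrightarrow>
     distinct ks \<and> set ks = S \<and>
     sorted_wrt (\<lambda>i k. val P i < val P k \<or> (val P i = val P k \<and> cpc P i \<le> cpc P k)) ks"

text \<open>Queries that agree in both value and cost may be listed in either order, so the procedure
  is a relation between its input and its possible outputs. For a fixed order, the equation below
  determines \<open>y\<close> on \<open>S\<close> by recursion from the last list position down to the first.\<close>

definition rounds_set ::
  "ad_program \<Rightarrow> (nat \<Rightarrow> real) \<Rightarrow> nat set \<Rightarrow> (nat \<Rightarrow> real) \<Rightarrow> bool" where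
  "rounds_set P x S y \<longleftrightarrow>
     (\<exists>ks. rounding_order P S ks \<and>
       (\<forall>j<length ks. y (ks ! j) =
          (if x (ks ! j) + (\<Sum>l\<in>{j<..<length ks}. x (ks ! l) - y (ks ! l)) \<ge> 1 then 1 else 0)))"

definition rounding_output :: "ad_program \<Rightarrow> (nat \<Rightarrow> real) \<Rightarrow> (nat \<Rightarrow> real) \<Rightarrow> bool" where
  "rounding_output P x y \<longleftrightarrow>
     (\<forall>g\<in>groups P. rounds_set P x (fractional_part_of_group P x g) y) \<and>
     (\<forall>i\<in>queries P. x i \<in> {0, 1} \<longrightarrow> y i = x i)"

end

theory Submission
  imports Defs
begin

text \<open>On one set, the fractional mass carried over to position \<open>j\<close>, i.e. the sum of \<open>x - y\<close> over the
  positions from \<open>j\<close> on, always stays in \<open>[0,1)\<close>. By Abel summation, \<open>\<Sum> w (x - y)\<close> therefore lies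
  between \<open>0\<close> and \<open>max w\<close> for every nonnegative weight \<open>w\<close> that is nondecreasing along the rounding
  order. The hypothesis on \<open>x\<close> makes the costs such a weight; the values and the constant \<open>1\<close> always
  are. Summing over the disjoint groups gives the three claims.\<close>

text \<open>Bridges the indexed sum in \<open>rounds_set_def\<close> and suffixes of the list, on
  which the inductions run.\<close>

lemma sum_nth_greaterThanLessThan_eq_sum_list:
  "(\<Sum>l\<in>{j<..<length ks}. f (ks ! l)) = sum_list (map f (drop (Suc j) ks))"
proof -
  have "sum_list (map f (drop (Suc j) ks)) = (\<Sum>l = 0..<length ks - Suc j. f (ks ! (l + Suc j)))"
    by (simp add: sum_list_sum_nth add.commute)
  also have "\<dots> = (\<Sum>l\<in>{j<..<length ks}. f (ks ! l))"
    by (rule sum.reindex_bij_witness[where i = "\<lambda>l. l - Suc j" and j = "\<lambda>l. l + Suc j"]) auto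
  finally show ?thesis by simp
qed

text \<open>Downward induction on \<open>j\<close>: the carry from later positions and
  \<open>x (ks ! j)\<close> both lie in \<open>[0,1)\<close>, so their sum lies in
  \<open>[0,2)\<close>. The rule subtracts 1 exactly when this sum reaches 1, which returns it to
  \<open>[0,1)\<close>.\<close>

lemma rounding_suffix_sum_bounds:
  fixes x y :: "'a \<Rightarrow> real"
  assumes x: "\<And>k. k \<in> set ks \<Longrightarrow> 0 \<le> x k \<and> x k < 1"
    and y: "\<And>j. j < length ks \<Longrightarrow> y (ks ! j) =
      (if x (ks ! j) + (\<Sum>l\<in>{j<..<length ks}. x (ks ! l) - y (ks ! l)) \<ge> 1 then 1 else 0)"
  shows "sum_list (map (\<lambda>k. x k - y k) (drop j ks)) \<in> {0..<1}"
proof (cases "j \<le> length ks")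
  case True
  then show ?thesis
  proof (induction rule: inc_induct)
    case base
    then show ?case by simp
  next
    case (step j)
    have "drop j ks = ks ! j # drop (Suc j) ks"
      using step.hyps by (simp add: Cons_nth_drop_Suc)
    moreover have "0 \<le> x (ks ! j) \<and> x (ks ! j) < 1"
      using step.hyps x by simp
    moreover have "y (ks ! j) =
        (if x (ks ! j) + sum_list (map (\<lambda>k. x k - y k) (drop (Suc j) ks)) \<ge> 1 then 1 else 0)"
      using y step.hyps
        sum_nth_greaterThanLessThan_eq_sum_list[where f = "\<lambda>k. x k - y k" and ks = ks and j = j]
      by simp
    ultimately show ?case
      using step.IH by auto
  qed
qed simp

text \<open>Abel summation as an induction with a moving baseline \<open>a\<close>. The first weight
  \<open>w k\<close> is the smallest; raising the baseline to it splits off \<open>w k - a\<close>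
  times the full sum of \<open>d\<close>, a term in \<open>[0, w k - a]\<close>. The remainder lies
  in \<open>[0, M - w k]\<close> by induction, and the bounds telescope.\<close>

lemma abel_sum_list_bounds:
  fixes d w :: "'a \<Rightarrow> real"
  assumes "sorted_wrt (\<lambda>i k. w i \<le> w k) ks"
    and "\<And>j. sum_list (map d (drop j ks)) \<in> {0..1}"
    and "\<And>k. k \<in> set ks \<Longrightarrow> a \<le> w k"
    and "\<And>k. k \<in> set ks \<Longrightarrow> w k \<le> M"
    and "a \<le> M"
  shows "sum_list (map (\<lambda>k. (w k - a) * d k) ks) \<in> {0..M - a}"
  using assms
proof (induction ks arbitrary: a)
  case Nil
  then show ?case by simp
next
  case (Cons k ks)
  let ?D = "sum_list (map d (k # ks))"
  have "sum_list (map d (drop j ks)) \<in> {0..1}" for j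
    using Cons.prems(2)[of "Suc j"] by simp
  then have IH: "sum_list (map (\<lambda>i. (w i - w k) * d i) ks) \<in> {0..M - w k}"
    using Cons.prems by (intro Cons.IH) auto
  \<comment> \<open>The induction hypothesis has baseline \<open>w k\<close>, the goal has baseline
    \<open>a\<close>; the tail pays for the difference.\<close>
  have shift: "sum_list (map (\<lambda>i. (w i - a) * d i) ks) =
      sum_list (map (\<lambda>i. (w i - w k) * d i) ks) + (w k - a) * sum_list (map d ks)"
    by (induction ks) (simp_all add: algebra_simps)
  have D: "0 \<le> ?D" "?D \<le> 1"
    using Cons.prems(2)[of 0] by auto
  have wk: "0 \<le> w k - a"
    using Cons.prems(3) by simp
  have "0 \<le> (w k - a) * ?D" "(w k - a) * ?D \<le> w k - a"
    using mult_nonneg_nonneg[OF wk D(1)] mult_left_le[OF D(2) wk] by auto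
  moreover have "sum_list (map (\<lambda>i. (w i - a) * d i) (k # ks)) =
      sum_list (map (\<lambda>i. (w i - w k) * d i) ks) + (w k - a) * ?D"
    unfolding list.map sum_list.Cons shift by (simp add: distrib_left)
  ultimately show ?case
    using IH by auto
qed

text \<open>Combines the carry bound with Abel summation at baseline 0. The weight stays abstract
  because costs, values and the constant 1 are all used later.\<close>

lemma rounds_set_weighted_sum_bounds:
  assumes rounds: "rounds_set P x S y"
    and x: "\<And>i. i \<in> S \<Longrightarrow> 0 \<le> x i \<and> x i < 1"
    and mono: "\<And>i k. \<lbrakk>i \<in> S; k \<in> S; val P i < val P k \<or> (val P i = val P k \<and> cpc P i \<le> cpc P k)\<rbrakk>
                 \<Longrightarrow> w i \<le> w k"
    and w: "\<And>i. i \<in> S \<Longrightarrow> 0 \<le> w i \<and> w i \<le> M" and "0 \<le> M"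
  shows "(\<Sum>i\<in>S. w i * (x i - y i)) \<in> {0..M}"
proof -
  obtain ks where ks: "distinct ks" "set ks = S"
    "sorted_wrt (\<lambda>i k. val P i < val P k \<or> (val P i = val P k \<and> cpc P i \<le> cpc P k)) ks"
    and y: "\<And>j. j < length ks \<Longrightarrow> y (ks ! j) =
      (if x (ks ! j) + (\<Sum>l\<in>{j<..<length ks}. x (ks ! l) - y (ks ! l)) \<ge> 1 then 1 else 0)"
    using rounds unfolding rounds_set_def rounding_order_def by blast
  have "sorted_wrt (\<lambda>i k. w i \<le> w k) ks"
    by (rule sorted_wrt_mono_rel[OF _ ks(3)]) (use mono ks(2) in auto)
  moreover have "sum_list (map (\<lambda>k. x k - y k) (drop j ks)) \<in> {0..1}" for j
    using rounding_suffix_sum_bounds[of ks x y j] x y ks(2) by fastforce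
  ultimately have "sum_list (map (\<lambda>k. (w k - 0) * (x k - y k)) ks) \<in> {0..M - 0}"
    using w ks(2) \<open>0 \<le> M\<close> by (intro abel_sum_list_bounds) auto
  then show ?thesis
    using ks by (simp add: sum_list_distinct_conv_sum_set)
qed

lemma sum_queries_disjoint_groups:
  assumes lp: "ad_allocation_lp P" and disj: "disjoint_groups P"
  shows "(\<Sum>i\<in>queries P. f i) = (\<Sum>g\<in>groups P. \<Sum>i\<in>g. f i)"
proof -
  have sub: "finite (groups P)" "\<And>g. g \<in> groups P \<Longrightarrow> g \<subseteq> queries P"
    using lp by (auto simp: ad_allocation_lp_def)
  have uniq: "\<And>i. i \<in> queries P \<Longrightarrow> \<exists>!g. g \<in> groups P \<and> i \<in> g"
    using disj by (simp add: disjoint_groups_def)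
  have "queries P = (\<Union>g\<in>groups P. g)"
    using sub(2) uniq by fast
  moreover have "(\<Sum>i\<in>(\<Union>g\<in>groups P. g). f i) = (\<Sum>g\<in>groups P. \<Sum>i\<in>g. f i)"
  proof (rule sum.UNION_disjoint)
    show "\<forall>g\<in>groups P. finite g"
      using sub(2) finite_subset by blast
    show "\<forall>g\<in>groups P. \<forall>h\<in>groups P. g \<noteq> h \<longrightarrow> g \<inter> h = {}"
      using sub(2) uniq by blast
  qed (fact sub(1))
  ultimately show ?thesis by simp
qed

theorem lemma6:
  fixes P :: ad_program and x y :: "nat \<Rightarrow> real" and vmax :: real
  assumes "ad_allocation_lp P"
    and "num P \<ge> 1"
    and "disjoint_groups P"
    and "\<forall>i\<in>queries P. ctr P i = 1"
    and "vmax = Max (val P ` queries P)"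
    and "feasible P x"
    and "\<forall>g\<in>groups P. \<forall>i\<in>g. \<forall>i'\<in>g.
           0 < x i \<and> x i < 1 \<and> 0 < x i' \<and> x i' < 1 \<longrightarrow>
           val P i > val P i' \<longrightarrow> cpc P i > cpc P i'"
    and "rounding_output P x y"
  shows "(\<Sum>i\<in>queries P. y i * cpc P i) \<le> (\<Sum>i\<in>queries P. x i * cpc P i) \<and>
         (\<Sum>i\<in>queries P. x i * cpc P i) \<le> budget P \<and>
         (\<forall>g\<in>groups P. (\<Sum>i\<in>queries P. y i * of_bool (i \<in> g)) + 1
            \<ge> target P g * (\<Sum>i\<in>queries P. y i)) \<and>
         (\<Sum>i\<in>queries P. y i * val P i) \<ge> objective P x - real (card (groups P)) * vmax"
proof -
  have sub: "\<And>g. g \<in> groups P \<Longrightarrow> g \<subseteq> queries P"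
    and target: "\<And>g. g \<in> groups P \<Longrightarrow> 0 \<le> target P g"
    and nonneg: "\<And>i. i \<in> queries P \<Longrightarrow> 0 \<le> cpc P i \<and> 0 \<le> val P i"
    using assms(1) by (auto simp: ad_allocation_lp_def)
  have x: "\<And>i. i \<in> queries P \<Longrightarrow> 0 \<le> x i \<and> x i \<le> 1"
    and cost: "(\<Sum>i\<in>queries P. x i * cpc P i) \<le> budget P"
    and parity: "\<And>g. g \<in> groups P \<Longrightarrow>
      (\<Sum>i\<in>queries P. x i * (target P g - of_bool (i \<in> g))) \<le> 0"
    using assms(4,6) by (simp_all add: feasible_def)
  have obj: "objective P x = (\<Sum>i\<in>queries P. x i * val P i)"
    using assms(4) by (simp add: objective_def)
  have vmax: "val P i \<le> vmax" if "i \<in> queries P" for i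
    using that by (simp add: assms(5))
  \<comment> \<open>A query must exist for the maximum value to inherit nonnegativity from the
    values.\<close>
  have "1 \<in> queries P"
    using assms(2) by simp
  then have vmax_nonneg: "0 \<le> vmax"
    using nonneg vmax order_trans by blast
  have group: "(\<Sum>i\<in>g. w i * (x i - y i)) \<in> {0..M}"
    if g: "g \<in> groups P"
      and mono: "\<And>i k. \<lbrakk>i \<in> fractional_part_of_group P x g; k \<in> fractional_part_of_group P x g;
        val P i < val P k \<or> (val P i = val P k \<and> cpc P i \<le> cpc P k)\<rbrakk> \<Longrightarrow> w i \<le> w k"
      and w: "\<And>i. i \<in> queries P \<Longrightarrow> 0 \<le> w i \<and> w i \<le> M" and "0 \<le> M"
    for g w M
  proof -
    let ?S = "fractional_part_of_group P x g"
    \<comment> \<open>Integral entries are copied by the rounding, so only the fractional part of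
      the group contributes.\<close>
    have "x i = y i" if "i \<in> g - ?S" for i
    proof -
      have "i \<in> queries P" "x i \<in> {0, 1}"
        using that g sub x[of i] by (fastforce simp: fractional_part_of_group_def)+
      then show ?thesis
        using assms(8) unfolding rounding_output_def by metis
    qed
    then have "(\<Sum>i\<in>g. w i * (x i - y i)) = (\<Sum>i\<in>?S. w i * (x i - y i))"
      using finite_subset[OF sub[OF g]]
      by (intro sum.mono_neutral_right) (auto simp: fractional_part_of_group_def)
    moreover have "(\<Sum>i\<in>?S. w i * (x i - y i)) \<in> {0..M}"
    proof (rule rounds_set_weighted_sum_bounds)
      show "rounds_set P x ?S y"
        using assms(8) g by (simp add: rounding_output_def)
    qed (use mono w \<open>0 \<le> M\<close> in \<open>auto simp: fractional_part_of_group_def\<close>)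
    ultimately show ?thesis by simp
  qed
  \<comment> \<open>The condition on \<open>x\<close> enters here: it settles strictly increasing
    values, while the tie-breaking rule settles equal ones.\<close>
  have cpc_mono: "cpc P i \<le> cpc P k"
    if "g \<in> groups P" "i \<in> fractional_part_of_group P x g" "k \<in> fractional_part_of_group P x g"
      "val P i < val P k \<or> (val P i = val P k \<and> cpc P i \<le> cpc P k)" for g i k
    using that assms(7) by (fastforce simp: fractional_part_of_group_def)
  \<comment> \<open>Only the lower bound 0 matters for costs; the total cost serves as a convenient
    upper bound \<open>M\<close>.\<close>
  have cpc_le: "cpc P i \<le> (\<Sum>i\<in>queries P. cpc P i)" if "i \<in> queries P" for i
    using that nonneg by (intro member_le_sum) auto
  have diff: "(\<Sum>i\<in>queries P. x i * w i) - (\<Sum>i\<in>queries P. y i * w i) =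
      (\<Sum>g\<in>groups P. \<Sum>i\<in>g. w i * (x i - y i))" for w
    unfolding sum_queries_disjoint_groups[OF assms(1,3), symmetric] sum_subtractf[symmetric]
    by (rule sum.cong) (simp_all add: algebra_simps)
  have g_cost: "0 \<le> (\<Sum>i\<in>g. cpc P i * (x i - y i))" if "g \<in> groups P" for g
  proof -
    have "(\<Sum>i\<in>g. cpc P i * (x i - y i)) \<in> {0..\<Sum>i\<in>queries P. cpc P i}"
      using nonneg cpc_le by (intro group[OF that] cpc_mono[OF that] conjI sum_nonneg) auto
    then show ?thesis by simp
  qed
  have g_val: "(\<Sum>i\<in>g. val P i * (x i - y i)) \<le> vmax" if "g \<in> groups P" for g
  proof -
    have "(\<Sum>i\<in>g. val P i * (x i - y i)) \<in> {0..vmax}"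
      using nonneg vmax vmax_nonneg by (intro group[OF that]) auto
    then show ?thesis by simp
  qed
  have g_count: "(\<Sum>i\<in>g. x i - y i) \<in> {0..1}" if "g \<in> groups P" for g
    using group[OF that, of "\<lambda>_. 1" 1] by simp

  have "(\<Sum>i\<in>queries P. y i * cpc P i) \<le> (\<Sum>i\<in>queries P. x i * cpc P i)"
  proof -
    have "0 \<le> (\<Sum>g\<in>groups P. \<Sum>i\<in>g. cpc P i * (x i - y i))"
      using g_cost by (rule sum_nonneg)
    then show ?thesis
      using diff[of "cpc P"] by simp
  qed
  moreover have "(\<Sum>i\<in>queries P. y i * of_bool (i \<in> g)) + 1 \<ge> target P g * (\<Sum>i\<in>queries P. y i)"
    if g: "g \<in> groups P" for g
  proof -
    have restrict: "(\<Sum>i\<in>queries P. z i * of_bool (i \<in> g)) = (\<Sum>i\<in>g. z i)" for z :: "nat \<Rightarrow> real"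
      using sub[OF g] by (simp add: of_bool_def if_distrib sum.If_cases Int_absorb1 cong: if_cong)
    \<comment> \<open>With weight 1, no group gains mass, so the total of \<open>y\<close> is at
      most that of \<open>x\<close>. Since the target is nonnegative, the constraint satisfied by
      \<open>x\<close> can then be applied.\<close>
    have "0 \<le> (\<Sum>h\<in>groups P. \<Sum>i\<in>h. x i - y i)"
      by (rule sum_nonneg) (use g_count in simp)
    then have "(\<Sum>i\<in>queries P. y i) \<le> (\<Sum>i\<in>queries P. x i)"
      using diff[of "\<lambda>_. 1"] by simp
    then have "target P g * (\<Sum>i\<in>queries P. y i) \<le> target P g * (\<Sum>i\<in>queries P. x i)"
      using target[OF g] by (rule mult_left_mono)
    also have "\<dots> \<le> (\<Sum>i\<in>g. x i)"
      using parity[OF g] restrict[of x]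
      by (simp add: right_diff_distrib sum_subtractf sum_distrib_left mult.commute)
    \<comment> \<open>The additive 1 is the most mass that rounding can remove from a single
      group.\<close>
    also have "\<dots> \<le> (\<Sum>i\<in>g. y i) + 1"
      using g_count[OF g] by (simp add: sum_subtractf)
    finally show ?thesis
      by (simp only: restrict)
  qed
  moreover have "(\<Sum>i\<in>queries P. y i * val P i) \<ge> objective P x - real (card (groups P)) * vmax"
  proof -
    \<comment> \<open>Each group loses at most \<open>vmax\<close> in value, and the losses add up
      over the groups.\<close>
    have "(\<Sum>g\<in>groups P. \<Sum>i\<in>g. val P i * (x i - y i)) \<le> real (card (groups P)) * vmax"
      using g_val by (rule sum_bounded_above)
    then show ?thesis
      using diff[of "val P"] by (simp add: obj)
  qed
  ultimately show ?thesis
    using cost by blast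
qed

end
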